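(* If $G=(V,E)$ is a $2$-edge-connected graph on $n$ vertices, then $H(G) \ge H(C_n)$, with equality if and only if $G \cong C_n$.
   Context: Graphs are finite and simple. $C_n$ denotes the cycle on $n$ vertices. A graph is $2$-edge-connected if it is connected and remains connected after deleting any single edge (for simple graphs this forces $n\ge 3$). The Harary index of a graph $G=(V,E)$ is $H(G)=\sum_{\{u,v\}\subseteq V,\,u\ne v} \frac{1}{d(u,v)}$, where $d(u,v)$ is the distance between $u$ and $v$ in $G$. *)

theory Defs
  imports Complex_Main
begin

locale fin_sgraph =
  fixes V :: "'a set" and E :: "'a set set"
  assumes finite_verts: "finite V"
    and edge_in_verts: "e \<in> E \<Longrightarrow> e \<subseteq> V"
    and edge_card: "e \<in> E \<Longrightarrow> card e = 2"

text \<open>A walk is given by its nonempty list of vertices, so its length is one less than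
  the length of the list.\<close>

definition walk_betw :: "'a set \<Rightarrow> 'a set set \<Rightarrow> 'a \<Rightarrow> 'a list \<Rightarrow> 'a \<Rightarrow> bool" where
  "walk_betw V E u xs v \<longleftrightarrow>
     xs \<noteq> [] \<and> hd xs = u \<and> last xs = v \<and> set xs \<subseteq> V \<and> successively (\<lambda>x y. {x, y} \<in> E) xs"

definition graph_connected :: "'a set \<Rightarrow> 'a set set \<Rightarrow> bool" where
  "graph_connected V E \<longleftrightarrow> V \<noteq> {} \<and> (\<forall>u\<in>V. \<forall>v\<in>V. \<exists>xs. walk_betw V E u xs v)"

text \<open>The one-vertex graph satisfies the condition on edge deletions vacuously; it is excluded
  by the usual convention. The bound \<open>card V \<ge> 3\<close> then follows, see below.\<close>

definition two_edge_connected :: "'a set \<Rightarrow> 'a set set \<Rightarrow> bool" where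
  "two_edge_connected V E \<longleftrightarrow>
     1 < card V \<and> graph_connected V E \<and> (\<forall>e\<in>E. graph_connected V (E - {e}))"

text \<open>Only meaningful when some walk joins \<open>u\<close> and \<open>v\<close>, as in a connected graph.\<close>

definition graph_dist :: "'a set \<Rightarrow> 'a set set \<Rightarrow> 'a \<Rightarrow> 'a \<Rightarrow> nat" where
  "graph_dist V E u v = (LEAST k. \<exists>xs. walk_betw V E u xs v \<and> length xs = Suc k)"

text \<open>The distance as a function of the unordered pair; well defined by symmetry, see
  \<open>pair_dist_doubleton\<close>.\<close>

definition pair_dist :: "'a set \<Rightarrow> 'a set set \<Rightarrow> 'a set \<Rightarrow> nat" where
  "pair_dist V E p = (THE k. \<exists>u v. p = {u, v} \<and> k = graph_dist V E u v)"

definition harary_index :: "'a set \<Rightarrow> 'a set set \<Rightarrow> real" where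
  "harary_index V E = (\<Sum>p | p \<subseteq> V \<and> card p = 2. 1 / real (pair_dist V E p))"

definition cycle_verts :: "nat \<Rightarrow> nat set" where
  "cycle_verts n = {..<n}"

text \<open>A simple graph, and the cycle on \<open>n\<close> vertices, for \<open>n \<ge> 3\<close>.\<close>

definition cycle_edges :: "nat \<Rightarrow> nat set set" where
  "cycle_edges n = {{i, Suc i mod n} | i. i < n}"

definition graph_iso :: "'a set \<Rightarrow> 'a set set \<Rightarrow> 'b set \<Rightarrow> 'b set set \<Rightarrow> bool" where
  "graph_iso V E V' E' \<longleftrightarrow>
     (\<exists>f. bij_betw f V V' \<and> (\<forall>u\<in>V. \<forall>v\<in>V. {u, v} \<in> E \<longleftrightarrow> {f u, f v} \<in> E'))"

lemma walk_betw_rev: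
  assumes "walk_betw V E u xs v"
  shows "walk_betw V E v (rev xs) u"
  using assms by (auto simp: walk_betw_def hd_rev last_rev successively_rev insert_commute)

lemma graph_dist_commute: "graph_dist V E u v = graph_dist V E v u"
proof -
  have "(\<exists>xs. walk_betw V E u xs v \<and> length xs = Suc k) \<longleftrightarrow>
        (\<exists>xs. walk_betw V E v xs u \<and> length xs = Suc k)" for k
    by (metis walk_betw_rev length_rev)
  then show ?thesis by (simp add: graph_dist_def)
qed

lemma pair_dist_doubleton: "pair_dist V E {u, v} = graph_dist V E u v"
  unfolding pair_dist_def
  by (rule the_equality) (auto simp: doubleton_eq_iff graph_dist_commute)

lemma graph_connected_has_incident_edge:
  assumes "graph_connected V E" "u \<in> V" "v \<in> V" "u \<noteq> v"
  obtains w where "w \<in> V" "{u, w} \<in> E"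
proof -
  obtain xs where xs: "walk_betw V E u xs v"
    using assms by (auto simp: graph_connected_def)
  then obtain w ys where "xs = u # w # ys"
    using assms(4) by (cases xs; cases "tl xs") (auto simp: walk_betw_def)
  with xs that show thesis by (auto simp: walk_betw_def)
qed

lemma two_edge_connected_card_ge_3:
  assumes "fin_sgraph V E" "two_edge_connected V E"
  shows "3 \<le> card V"
proof (rule ccontr)
  interpret fin_sgraph V E by fact
  assume "\<not> 3 \<le> card V"
  with assms(2) have "card V = 2" by (auto simp: two_edge_connected_def)
  then obtain a b where ab: "V = {a, b}" "a \<noteq> b" by (auto simp: card_2_iff)
  have only: "e = {a, b}" if "e \<in> E" for e
    using card_subset_eq[OF finite_verts edge_in_verts[OF that]] edge_card[OF that]
      \<open>card V = 2\<close> ab by simp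
  obtain w where "{a, w} \<in> E"
    using graph_connected_has_incident_edge[of V E a b] assms(2) ab
    by (auto simp: two_edge_connected_def)
  then have "{a, b} \<in> E" using only by metis
  then have "graph_connected V (E - {{a, b}})"
    using assms(2) by (auto simp: two_edge_connected_def)
  then obtain w' where "{a, w'} \<in> E - {{a, b}}"
    using graph_connected_has_incident_edge[of V _ a b] ab by blast
  with only show False by blast
qed

lemma fin_sgraph_cycle:
  assumes "3 \<le> n"
  shows "fin_sgraph (cycle_verts n) (cycle_edges n)"
proof
  fix e assume "e \<in> cycle_edges n"
  then obtain i where i: "i < n" "e = {i, Suc i mod n}" by (auto simp: cycle_edges_def)
  then show "e \<subseteq> cycle_verts n" by (auto simp: cycle_verts_def)
  have "Suc i mod n \<noteq> i" using i(1) assms by (cases "Suc i = n") auto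
  then show "card e = 2" using i by simp
qed (simp add: cycle_verts_def)

end

theory Submission imports Defs begin

text \<open>
  Suppose that around every vertex every distance layer except the last has at least two vertices.
  Then the reciprocal distances from each vertex sum to at least the corresponding sum in the cycle,
  with equality only if that vertex has degree 2; and a connected 2-regular graph is a cycle.
  Otherwise some layer around a vertex \<open>u\<close> is a single vertex \<open>w\<close>, which separates the vertices
  nearer to \<open>u\<close> from those farther away. The two parts sharing \<open>w\<close> are again 2-edge-connected, so
  induction applies to both. In either part \<open>w\<close> has at least two neighbours and no later layer
  around it is empty. This alone makes the reciprocal distances between the parts sum to more than
  \<open>H(C\<^sub>n)\<close> gains over the two smaller cycles, a gain which is the sum of the second differences of
  \<open>H(C\<^sub>m\<^sub>+\<^sub>1)\<close> in \<open>m\<close> over a rectangle.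
\<close>

section \<open>Cycles glued at a vertex\<close>

text \<open>The reciprocal distances from a vertex of the cycle on \<open>m + 1\<close> vertices: counting only the
  other vertices makes the size additive when two graphs are glued at a vertex.\<close>

definition cycle_transmission :: "nat \<Rightarrow> real" where
  "cycle_transmission m = (\<Sum>i<m. 1 / real (i div 2 + 1))"

definition cycle_harary :: "nat \<Rightarrow> real" where
  "cycle_harary m = real (m + 1) * cycle_transmission m / 2"

text \<open>Sorted by distance from the common vertex, the \<open>i\<close>-th other vertex of a part, counting from 0,
  has distance at most \<open>max 1 i\<close>.\<close>

definition cross_sum :: "nat \<Rightarrow> nat \<Rightarrow> real" where
  "cross_sum m k = (\<Sum>i<m. \<Sum>j<k. 1 / real (max 1 i + max 1 j))"

definition gluing_excess :: "nat \<Rightarrow> nat \<Rightarrow> real" where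
  "gluing_excess m k = cycle_harary m + cycle_harary k + cross_sum m k - cycle_harary (m + k)"

definition cycle_harary_diff2 :: "nat \<Rightarrow> real" where
  "cycle_harary_diff2 p = (if even p then 1 / real (p div 2 + 1) else 0)"

lemma cycle_harary_second_difference:
  "(cycle_harary (p + 2) - cycle_harary (p + 1)) - (cycle_harary (p + 1) - cycle_harary p) =
     cycle_harary_diff2 p"
proof -
  define a where "a i = 1 / real (i div 2 + 1)" for i :: nat
  have Suc: "cycle_transmission (Suc i) = cycle_transmission i + a i" for i
    by (simp add: cycle_transmission_def a_def)
  have "(cycle_harary (p + 2) - cycle_harary (p + 1)) - (cycle_harary (p + 1) - cycle_harary p) =
      (real (p + 3) * a (p + 1) - real (p + 1) * a p) / 2"
    by (simp add: cycle_harary_def Suc numeral_eq_Suc field_simps)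
  also have "\<dots> = cycle_harary_diff2 p"
  proof (cases "even p")
    case True
    then have "a (p + 1) = a p" "cycle_harary_diff2 p = a p"
      by (simp_all add: a_def cycle_harary_diff2_def)
    then show ?thesis by (simp add: algebra_simps)
  next
    case False
    then show ?thesis by (auto elim!: oddE simp: a_def cycle_harary_diff2_def field_simps)
  qed
  finally show ?thesis .
qed

lemma sum_second_differences:
  fixes f :: "nat \<Rightarrow> 'a::ab_group_add"
  shows "(\<Sum>i<m. \<Sum>j<k. (f (i + j + 2) - f (i + j + 1)) - (f (i + j + 1) - f (i + j))) =
    f (m + k) - f m - f k + f 0"
proof -
  have "(\<Sum>j<k. (f (i + j + 2) - f (i + j + 1)) - (f (i + j + 1) - f (i + j))) =
      (f (Suc i + k) - f (i + k)) - (f (Suc i) - f i)" for i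
    using sum_lessThan_telescope[of "\<lambda>j. f (i + j + 1) - f (i + j)" k] by simp
  then show ?thesis
    using sum_lessThan_telescope[of "\<lambda>i. f (i + k)" m] sum_lessThan_telescope[of f m]
    by (simp add: sum_subtractf)
qed

lemma gluing_excess_eq_sum:
  "gluing_excess m k = (\<Sum>i<m. \<Sum>j<k. 1 / real (max 1 i + max 1 j) - cycle_harary_diff2 (i + j))"
proof -
  have "(\<Sum>i<m. \<Sum>j<k. cycle_harary_diff2 (i + j)) =
      cycle_harary (m + k) - cycle_harary m - cycle_harary k + cycle_harary 0"
    unfolding cycle_harary_second_difference[symmetric] by (rule sum_second_differences)
  moreover have "cycle_harary 0 = 0"
    by (simp add: cycle_harary_def cycle_transmission_def)
  ultimately show ?thesis
    by (simp add: gluing_excess_def cross_sum_def sum_subtractf)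
qed

lemma gluing_excess_commute: "gluing_excess m k = gluing_excess k m"
  unfolding gluing_excess_eq_sum by (subst sum.swap) (simp add: add.commute)

text \<open>Of the two vertically adjacent cells \<open>(m, j)\<close> and \<open>(m + 1, j)\<close> only one has a nonzero second
  difference, and that is paid for by the reciprocals of both.\<close>

lemma gluing_excess_add_2: "gluing_excess m k \<le> gluing_excess (m + 2) k"
proof -
  have cells: "cycle_harary_diff2 (m + j) + cycle_harary_diff2 (Suc m + j) \<le>
      1 / real (max 1 m + max 1 j) + 1 / real (max 1 (Suc m) + max 1 j)" for j
  proof -
    have "1 / real (m + j + 2) \<le> 1 / real (max 1 m + max 1 j)"
      "1 / real (m + j + 2) \<le> 1 / real (max 1 (Suc m) + max 1 j)"
      by (rule divide_left_mono; simp add: max_def)+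
    moreover have "cycle_harary_diff2 p + cycle_harary_diff2 (Suc p) \<le> 2 / real (p + 2)" for p
      by (cases "even p") (auto elim!: evenE oddE simp: cycle_harary_diff2_def field_simps)
    from this[of "m + j"] have
      "cycle_harary_diff2 (m + j) + cycle_harary_diff2 (Suc m + j) \<le> 2 / real (m + j + 2)" by simp
    ultimately show ?thesis by simp
  qed
  have "(\<Sum>j<k. cycle_harary_diff2 (m + j) + cycle_harary_diff2 (Suc m + j)) \<le>
      (\<Sum>j<k. 1 / real (max 1 m + max 1 j) + 1 / real (max 1 (Suc m) + max 1 j))"
    by (rule sum_mono) (rule cells)
  then show ?thesis
    by (simp add: gluing_excess_eq_sum numeral_2_eq_2 sum.distrib sum_subtractf add.assoc)
qed

lemma gluing_excess_mod_2_le: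
  assumes "2 \<le> m"
  shows "gluing_excess (2 + m mod 2) k \<le> gluing_excess m k"
  using assms
proof (induction m rule: less_induct)
  case (less m)
  show ?case
  proof (cases "m \<le> 3")
    case True
    with less.prems have "2 + m mod 2 = m" by presburger
    then show ?thesis by simp
  next
    case False
    define l where "l = m - 2"
    have "m = l + 2" "2 \<le> l" using False by (simp_all add: l_def)
    with less.IH[of l] gluing_excess_add_2[of l k] show ?thesis by simp
  qed
qed

lemma gluing_excess_pos:
  assumes "2 \<le> m" "2 \<le> k"
  shows "0 < gluing_excess m k"
proof -
  have small: "0 < gluing_excess a b" if "a \<in> {2, 3}" "b \<in> {2, 3}" for a b
    using that
    by (auto simp: gluing_excess_eq_sum cycle_harary_diff2_def lessThan_nat_numeral lessThan_Suc)
  have "2 + l mod 2 \<in> {2, 3}" for l :: nat by (cases "even l") auto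
  then have "0 < gluing_excess (2 + m mod 2) (2 + k mod 2)" using small by blast
  also have "\<dots> \<le> gluing_excess m (2 + k mod 2)" by (rule gluing_excess_mod_2_le[OF assms(1)])
  also have "\<dots> \<le> gluing_excess m k"
    using gluing_excess_mod_2_le[OF assms(2)] by (simp only: gluing_excess_commute[of m])
  finally show ?thesis .
qed

section \<open>Ordering a finite set by rank\<close>

lemma enumerate_by_key:
  fixes d :: "'a \<Rightarrow> 'b::linorder"
  assumes "finite A"
  obtains f where "bij_betw f {..<card A} A"
    and "\<And>i j. i \<le> j \<Longrightarrow> j < card A \<Longrightarrow> d (f i) \<le> d (f j)"
proof -
  obtain xs where xs: "set xs = A" "distinct xs" using finite_distinct_list[OF assms] by blast
  define ys where "ys = sort_key d xs"
  have ys: "set ys = A" "distinct ys" "length ys = card A" "sorted (map d ys)"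
    using xs distinct_card[OF xs(2)] by (simp_all add: ys_def)
  show thesis
  proof
    show "bij_betw ((!) ys) {..<card A} A" using bij_betw_nth[OF ys(2)] ys by simp
    show "d (ys ! i) \<le> d (ys ! j)" if "i \<le> j" "j < card A" for i j
      using sorted_nth_mono[OF ys(4)] that ys(3) by simp
  qed
qed

lemma sum_ge_by_rank:
  fixes d :: "'a \<Rightarrow> 'b::linorder" and h :: "'a \<Rightarrow> 'c::ordered_comm_monoid_add"
  assumes "finite A"
    and bound: "\<And>x i. x \<in> A \<Longrightarrow> card {y \<in> A. d y < d x} \<le> i \<Longrightarrow> g i \<le> h x"
  shows "(\<Sum>i<card A. g i) \<le> (\<Sum>x\<in>A. h x)"
proof -
  obtain f where f: "bij_betw f {..<card A} A"
    and mono: "\<And>i j. i \<le> j \<Longrightarrow> j < card A \<Longrightarrow> d (f i) \<le> d (f j)"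
    using enumerate_by_key[OF assms(1), of d] by blast
  have "(\<Sum>i<card A. g i) \<le> (\<Sum>i<card A. h (f i))"
  proof (rule sum_mono)
    fix i assume i: "i \<in> {..<card A}"
    have "{y \<in> A. d y < d (f i)} \<subseteq> f ` {..<i}"
    proof
      fix y assume y: "y \<in> {y \<in> A. d y < d (f i)}"
      then obtain j where "j < card A" "y = f j" using f by (auto simp: bij_betw_def)
      with y mono[of i j] show "y \<in> f ` {..<i}" by (cases "j < i") auto
    qed
    from surj_card_le[OF _ this] show "g i \<le> h (f i)"
      using bound bij_betwE[OF f] i by simp
  qed
  also have "\<dots> = (\<Sum>x\<in>A. h x)" by (rule sum.reindex_bij_betw[OF f])
  finally show ?thesis .
qed

lemma sum_le_by_rank:
  fixes d :: "'a \<Rightarrow> 'b::linorder" and h :: "'a \<Rightarrow> 'c::ordered_comm_monoid_add"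
  assumes "finite A"
    and bound: "\<And>x i. x \<in> A \<Longrightarrow> i < card {y \<in> A. d y \<le> d x} \<Longrightarrow> h x \<le> g i"
  shows "(\<Sum>x\<in>A. h x) \<le> (\<Sum>i<card A. g i)"
proof -
  obtain f where f: "bij_betw f {..<card A} A"
    and mono: "\<And>i j. i \<le> j \<Longrightarrow> j < card A \<Longrightarrow> d (f i) \<le> d (f j)"
    using enumerate_by_key[OF assms(1), of d] by blast
  have "(\<Sum>x\<in>A. h x) = (\<Sum>i<card A. h (f i))" by (rule sum.reindex_bij_betw[OF f, symmetric])
  also have "\<dots> \<le> (\<Sum>i<card A. g i)"
  proof (rule sum_mono)
    fix i assume i: "i \<in> {..<card A}"
    have "f ` {..i} \<subseteq> {y \<in> A. d y \<le> d (f i)}" using mono bij_betwE[OF f] i by auto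
    moreover have "inj_on f {..i}" using f i by (auto simp: bij_betw_def intro: inj_on_subset)
    ultimately have "card {..i} \<le> card {y \<in> A. d y \<le> d (f i)}"
      using assms(1) by (intro card_inj_on_le) auto
    then show "h (f i) \<le> g i" using bound bij_betwE[OF f] i by simp
  qed
  finally show ?thesis .
qed

section \<open>Walks, distances and weak homomorphisms\<close>

lemma walk_betw_single: "u \<in> V \<Longrightarrow> walk_betw V E u [u] u"
  by (simp add: walk_betw_def)

lemma walk_betw_Cons:
  assumes "walk_betw V E v xs z" "u \<in> V" "{u, v} \<in> E"
  shows "walk_betw V E u (u # xs) z"
  using assms by (auto simp: walk_betw_def successively_Cons)

lemma walk_betw_append:
  assumes "walk_betw V E u xs v" "walk_betw V E v ys z"
  shows "walk_betw V E u (xs @ tl ys) z"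
proof -
  obtain zs where "ys = v # zs" using assms(2) by (cases ys) (auto simp: walk_betw_def)
  with assms show ?thesis
    by (cases zs) (auto simp: walk_betw_def successively_append_iff)
qed

lemma graph_dist_less_length:
  assumes "walk_betw V E u xs v"
  shows "graph_dist V E u v < length xs"
proof -
  have length: "length xs = Suc (length xs - 1)" using assms by (auto simp: walk_betw_def)
  then have "graph_dist V E u v \<le> length xs - 1"
    unfolding graph_dist_def using assms by (intro Least_le) blast
  with length show ?thesis by linarith
qed

lemma shortest_walk:
  assumes "walk_betw V E u xs v"
  obtains ys where "walk_betw V E u ys v" "length ys = Suc (graph_dist V E u v)"
proof -
  have "length xs = Suc (length xs - 1)" using assms by (auto simp: walk_betw_def)
  with assms have "\<exists>k ys. walk_betw V E u ys v \<and> length ys = Suc k" by blast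
  from LeastI_ex[OF this] show thesis using that unfolding graph_dist_def by blast
qed

lemma graph_dist_self: "u \<in> V \<Longrightarrow> graph_dist V E u u = 0"
  using graph_dist_less_length[OF walk_betw_single, of u V E] by simp

definition weak_hom :: "('a \<Rightarrow> 'b) \<Rightarrow> 'a set \<Rightarrow> 'a set set \<Rightarrow> 'b set \<Rightarrow> 'b set set \<Rightarrow> bool" where
  "weak_hom f V E V' E' \<longleftrightarrow>
     f ` V \<subseteq> V' \<and> (\<forall>x\<in>V. \<forall>y\<in>V. {x, y} \<in> E \<longrightarrow> f x = f y \<or> {f x, f y} \<in> E')"

lemma weak_hom_walk:
  assumes hom: "weak_hom f V E V' E'" and walk: "walk_betw V E u xs v"
  shows "\<exists>ys. walk_betw V' E' (f u) ys (f v) \<and> length ys \<le> length xs"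
  using walk
proof (induction xs arbitrary: u rule: induct_list012)
  case 1
  then show ?case by (simp add: walk_betw_def)
next
  case (2 x)
  then have "walk_betw V' E' (f u) [f u] (f v)"
    using hom by (auto simp: walk_betw_def weak_hom_def)
  then show ?case by (intro exI[of _ "[f u]"]) simp
next
  case (3 x y zs)
  then have tail: "walk_betw V E y (y # zs) v" and step: "x = u" "u \<in> V" "y \<in> V" "{u, y} \<in> E"
    by (auto simp: walk_betw_def)
  obtain ys where ys: "walk_betw V' E' (f y) ys (f v)" "length ys \<le> length (y # zs)"
    using "3.IH"(2)[OF tail] by blast
  consider (collapsed) "f u = f y" | (edge) "{f u, f y} \<in> E'" "f u \<in> V'"
    using hom step by (auto simp: weak_hom_def)
  then show ?case
  proof cases
    case collapsed
    with ys show ?thesis by (intro exI[of _ ys]) simp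
  next
    case edge
    with ys show ?thesis by (intro exI[of _ "f u # ys"]) (simp add: walk_betw_Cons)
  qed
qed

lemma weak_hom_graph_connected:
  assumes "weak_hom f V E V' E'" "f ` V = V'" "graph_connected V E"
  shows "graph_connected V' E'"
  unfolding graph_connected_def
proof (intro conjI ballI)
  show "V' \<noteq> {}" using assms(2,3) by (auto simp: graph_connected_def)
  fix u' v' assume "u' \<in> V'" "v' \<in> V'"
  then obtain u v where "u \<in> V" "v \<in> V" "u' = f u" "v' = f v" using assms(2) by blast
  then show "\<exists>xs. walk_betw V' E' u' xs v'"
    using weak_hom_walk[OF assms(1)] assms(3) unfolding graph_connected_def by blast
qed

lemma weak_hom_subgraph: "V \<subseteq> V' \<Longrightarrow> E \<subseteq> E' \<Longrightarrow> weak_hom id V E V' E'"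
  by (auto simp: weak_hom_def)

definition neighbours :: "'a set \<Rightarrow> 'a set set \<Rightarrow> 'a \<Rightarrow> 'a set" where
  "neighbours V E u = {v \<in> V. {u, v} \<in> E}"

definition regular_graph :: "'a set \<Rightarrow> 'a set set \<Rightarrow> nat \<Rightarrow> bool" where
  "regular_graph V E k \<longleftrightarrow> (\<forall>u\<in>V. card (neighbours V E u) = k)"

context fin_sgraph
begin

lemma adjacent_in_verts:
  assumes "{u, v} \<in> E"
  shows "u \<in> V" "v \<in> V" "u \<noteq> v"
  using edge_in_verts[OF assms] edge_card[OF assms] by auto

lemma in_neighbours_iff: "v \<in> neighbours V E u \<longleftrightarrow> {u, v} \<in> E"
  using adjacent_in_verts(2) by (auto simp: neighbours_def)

lemma neighbours_sym: "v \<in> neighbours V E u \<Longrightarrow> u \<in> neighbours V E v"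
  by (simp add: in_neighbours_iff insert_commute)

lemma finite_neighbours: "finite (neighbours V E u)"
  using finite_verts by (simp add: neighbours_def)

end

locale connected_sgraph = fin_sgraph V E for V :: "'a set" and E +
  assumes connected: "graph_connected V E"
begin

abbreviation "d \<equiv> graph_dist V E"

lemma geodesic:
  assumes "u \<in> V" "v \<in> V"
  obtains xs where "walk_betw V E u xs v" "length xs = Suc (d u v)"
  using assms connected shortest_walk[of V E u _ v] unfolding graph_connected_def by blast

lemma verts_subset_if_closed:
  assumes "u \<in> V" "u \<in> S" and closed: "\<And>x. x \<in> V \<Longrightarrow> x \<in> S \<Longrightarrow> neighbours V E x \<subseteq> S"
  shows "V \<subseteq> S"
proof
  fix v assume "v \<in> V"
  then obtain xs where "walk_betw V E u xs v"
    using connected assms(1) unfolding graph_connected_def by blast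
  then show "v \<in> S"
    using assms(2)
  proof (induction xs arbitrary: u rule: induct_list012)
    case (3 x y zs)
    then have "walk_betw V E y (y # zs) v" by (auto simp: walk_betw_def)
    moreover have "y \<in> S"
      using "3.prems" closed[of u] by (auto simp: walk_betw_def neighbours_def)
    ultimately show ?case by (rule "3.IH"(2))
  qed (auto simp: walk_betw_def)
qed

lemma dist_pos_iff:
  assumes "u \<in> V" "v \<in> V"
  shows "0 < d u v \<longleftrightarrow> u \<noteq> v"
proof
  assume "u \<noteq> v"
  show "0 < d u v"
  proof (rule ccontr)
    assume "\<not> 0 < d u v"
    then obtain xs where "walk_betw V E u xs v" "length xs = 1" using geodesic[OF assms] by auto
    with \<open>u \<noteq> v\<close> show False by (auto simp: walk_betw_def length_Suc_conv)
  qed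
qed (use assms graph_dist_self in force)

lemma dist_triangle:
  assumes "u \<in> V" "v \<in> V" "z \<in> V"
  shows "d u z \<le> d u v + d v z"
proof -
  obtain xs where xs: "walk_betw V E u xs v" "length xs = Suc (d u v)"
    by (rule geodesic[OF assms(1,2)])
  obtain ys where ys: "walk_betw V E v ys z" "length ys = Suc (d v z)"
    by (rule geodesic[OF assms(2,3)])
  show ?thesis
    using graph_dist_less_length[OF walk_betw_append[OF xs(1) ys(1)]] xs(2) ys(2) by simp
qed

lemma dist_eq_1_iff:
  assumes "u \<in> V" "v \<in> V"
  shows "d u v = 1 \<longleftrightarrow> v \<in> neighbours V E u"
proof
  assume "d u v = 1"
  then obtain xs where "walk_betw V E u xs v" "length xs = Suc (Suc 0)"
    using geodesic[OF assms] by auto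
  then show "v \<in> neighbours V E u" by (auto simp: walk_betw_def length_Suc_conv neighbours_def)
next
  assume "v \<in> neighbours V E u"
  then have edge: "{u, v} \<in> E" by (simp add: in_neighbours_iff)
  then have "walk_betw V E u [u, v] v" using assms by (simp add: walk_betw_def)
  then have "d u v < length [u, v]" by (rule graph_dist_less_length)
  moreover have "0 < d u v" using dist_pos_iff[OF assms] adjacent_in_verts(3)[OF edge] by simp
  ultimately show "d u v = 1" by simp
qed

lemma dist_adjacent_le:
  assumes "u \<in> V" "{x, y} \<in> E"
  shows "d u y \<le> Suc (d u x)"
  using dist_triangle[OF assms(1) adjacent_in_verts(1,2)[OF assms(2)]]
    dist_eq_1_iff[OF adjacent_in_verts(1,2)[OF assms(2)]] assms(2) by (simp add: in_neighbours_iff)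

lemma dist_predecessor:
  assumes "u \<in> V" "v \<in> V" "d u v = Suc k"
  obtains y where "y \<in> neighbours V E v" "d u y = k"
proof -
  obtain xs where xs: "walk_betw V E u xs v" "length xs = Suc (Suc k)"
    using geodesic[OF assms(1,2)] assms(3) by metis
  then obtain ys where ys: "xs = ys @ [v]" "length ys = Suc k"
    by (cases xs rule: rev_cases) (auto simp: walk_betw_def)
  then obtain zs y where zs: "ys = zs @ [y]" by (cases ys rule: rev_cases) auto
  have walk: "walk_betw V E u ys y" and edge: "{y, v} \<in> E"
    using xs ys zs by (auto simp: walk_betw_def successively_append_iff hd_append split: if_splits)
  have "d u y \<le> k" using graph_dist_less_length[OF walk] ys(2) by simp
  moreover have "Suc k \<le> Suc (d u y)" using dist_adjacent_le[OF assms(1) edge] assms(3) by simp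
  ultimately show thesis
    using that edge by (simp add: in_neighbours_iff insert_commute)
qed

lemma weak_hom_dist_le:
  assumes "weak_hom f V E V' E'" "u \<in> V" "v \<in> V"
  shows "graph_dist V' E' (f u) (f v) \<le> d u v"
proof -
  obtain xs where xs: "walk_betw V E u xs v" "length xs = Suc (d u v)"
    by (rule geodesic[OF assms(2,3)])
  obtain ys where "walk_betw V' E' (f u) ys (f v)" "length ys \<le> length xs"
    using weak_hom_walk[OF assms(1) xs(1)] by blast
  with graph_dist_less_length xs(2) show ?thesis by fastforce
qed

lemma inverse_dist_le_if_inj_weak_hom:
  assumes "connected_sgraph V' E'" "weak_hom f V E V' E'" "inj_on f V" "u \<in> V" "v \<in> V"
  shows "1 / real (d u v) \<le> 1 / real (graph_dist V' E' (f u) (f v))"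
proof -
  interpret H: connected_sgraph V' E' by fact
  have in_H: "f u \<in> V'" "f v \<in> V'" using assms(2,4,5) by (auto simp: weak_hom_def)
  show ?thesis
  proof (cases "u = v")
    case True
    then show ?thesis using in_H assms(4) by (simp add: graph_dist_self)
  next
    case False
    then have "0 < H.d (f u) (f v)"
      using H.dist_pos_iff[OF in_H] assms(3-5) by (simp add: inj_on_eq_iff)
    with weak_hom_dist_le[OF assms(2,4,5)] show ?thesis by (intro divide_left_mono) auto
  qed
qed

definition reciprocal_transmission :: "'a \<Rightarrow> real" where
  "reciprocal_transmission u = (\<Sum>v\<in>V. 1 / real (d u v))"

text \<open>The diagonal terms are \<open>1 / 0 = 0\<close>.\<close>

lemma harary_index_eq_sum:
  "2 * harary_index V E = (\<Sum>u\<in>V. reciprocal_transmission u)"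
proof -
  let ?S = "{(u, v). u \<in> V \<and> v \<in> V \<and> u \<noteq> v}"
  let ?T = "{p. p \<subseteq> V \<and> card p = 2}"
  let ?g = "\<lambda>(u, v). 1 / real (d u v)"
  have fin: "finite ?S" "finite ?T"
    using finite_verts by (auto intro: finite_subset[of _ "V \<times> V"])
  have "(\<Sum>u\<in>V. reciprocal_transmission u) = sum ?g (V \<times> V)"
    by (simp add: reciprocal_transmission_def sum.cartesian_product)
  also have "\<dots> = sum ?g ?S"
    by (rule sum.mono_neutral_right) (auto simp: finite_verts graph_dist_self)
  also have "\<dots> = (\<Sum>p\<in>?T. sum ?g {q \<in> ?S. (\<lambda>(u, v). {u, v}) q = p})"
    by (rule sum.group[symmetric]) (auto simp: fin)
  also have "\<dots> = (\<Sum>p\<in>?T. 2 * (1 / real (pair_dist V E p)))"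
  proof (rule sum.cong)
    fix p assume "p \<in> ?T"
    then obtain a b where ab: "p = {a, b}" "a \<noteq> b" "a \<in> V" "b \<in> V" by (auto simp: card_2_iff)
    then have "{q \<in> ?S. (\<lambda>(u, v). {u, v}) q = p} = {(a, b), (b, a)}"
      by (auto simp: doubleton_eq_iff)
    with ab show "sum ?g {q \<in> ?S. (\<lambda>(u, v). {u, v}) q = p} = 2 * (1 / real (pair_dist V E p))"
      by (simp add: pair_dist_doubleton graph_dist_commute[of V E b a])
  qed simp
  finally show ?thesis by (simp add: harary_index_def sum_distrib_left)
qed

end

lemma harary_index_le_if_bij_weak_hom:
  assumes "connected_sgraph V E" "connected_sgraph V' E'" "bij_betw f V V'" "weak_hom f V E V' E'"
  shows "harary_index V E \<le> harary_index V' E'"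
proof -
  interpret G: connected_sgraph V E by fact
  interpret H: connected_sgraph V' E' by fact
  have "2 * harary_index V E \<le> (\<Sum>u\<in>V. \<Sum>v\<in>V. 1 / real (H.d (f u) (f v)))"
    unfolding G.harary_index_eq_sum G.reciprocal_transmission_def
    using assms(3) by (intro sum_mono G.inverse_dist_le_if_inj_weak_hom[OF assms(2,4)])
      (auto simp: bij_betw_def)
  also have "\<dots> = 2 * harary_index V' E'"
    unfolding H.harary_index_eq_sum H.reciprocal_transmission_def
      sum.reindex_bij_betw[OF assms(3), symmetric] ..
  finally show ?thesis by simp
qed

lemma graph_iso_sym:
  assumes "graph_iso V E V' E'"
  shows "graph_iso V' E' V E"
proof -
  obtain f where f: "bij_betw f V V'" "\<forall>u\<in>V. \<forall>v\<in>V. {u, v} \<in> E \<longleftrightarrow> {f u, f v} \<in> E'"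
    using assms by (auto simp: graph_iso_def)
  define g where "g = the_inv_into V f"
  have g: "bij_betw g V' V" unfolding g_def by (rule bij_betw_the_inv_into[OF f(1)])
  have "f (g y) = y" if "y \<in> V'" for y
    using f(1) that by (auto simp: g_def bij_betw_def intro: f_the_inv_into_f)
  then show ?thesis
    unfolding graph_iso_def using f(2) g by (intro exI[of _ g]) (simp add: bij_betw_apply)
qed

lemma graph_iso_weak_hom:
  "graph_iso V E V' E' \<Longrightarrow> \<exists>f. bij_betw f V V' \<and> weak_hom f V E V' E'"
  by (fastforce simp: graph_iso_def weak_hom_def bij_betw_def)

lemma harary_index_iso:
  assumes "connected_sgraph V E" "connected_sgraph V' E'" "graph_iso V E V' E'"
  shows "harary_index V E = harary_index V' E'"
proof -
  obtain f where f: "bij_betw f V V'" "weak_hom f V E V' E'"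
    using graph_iso_weak_hom[OF assms(3)] by blast
  obtain g where g: "bij_betw g V' V" "weak_hom g V' E' V E"
    using graph_iso_weak_hom[OF graph_iso_sym[OF assms(3)]] by blast
  show ?thesis
    using harary_index_le_if_bij_weak_hom[OF assms(1,2) f]
      harary_index_le_if_bij_weak_hom[OF assms(2,1) g] by (rule antisym)
qed

section \<open>Distance layers\<close>

context connected_sgraph
begin

definition layer :: "'a \<Rightarrow> nat \<Rightarrow> 'a set" where
  "layer w k = {x \<in> V. d w x = k}"

lemma finite_layer: "finite (layer w k)"
  using finite_verts by (simp add: layer_def)

lemma layer_1: "w \<in> V \<Longrightarrow> layer w 1 = neighbours V E w"
  using dist_eq_1_iff by (auto simp: layer_def neighbours_def)

lemma layer_nonempty:
  assumes "w \<in> V" "v \<in> V" "k \<le> d w v"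
  shows "layer w k \<noteq> {}"
  using assms(2,3)
proof (induction "d w v - k" arbitrary: v)
  case 0
  then show ?case by (auto simp: layer_def)
next
  case (Suc m)
  then obtain l where l: "d w v = Suc l" by (cases "d w v") auto
  obtain y where y: "y \<in> neighbours V E v" "d w y = l"
    using dist_predecessor[OF assms(1) Suc.prems(1) l] by metis
  show ?case
  proof (cases "k = Suc l")
    case True
    with Suc.prems(1) l show ?thesis by (auto simp: layer_def)
  next
    case False
    with Suc.hyps(1)[of y] Suc.hyps(2) Suc.prems l y show ?thesis by (simp add: neighbours_def)
  qed
qed

lemma card_dist_less:
  assumes "w \<in> V"
  shows "card {y \<in> V - {w}. d w y < k} = (\<Sum>j=1..<k. card (layer w j))"
proof -
  have "{y \<in> V - {w}. d w y < k} = (\<Union>j\<in>{1..<k}. layer w j)"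
    using dist_pos_iff[OF assms] assms by (force simp: layer_def graph_dist_self)
  then show ?thesis
    using card_UN_disjoint[of "{1..<k}" "layer w"] finite_layer by (auto simp: layer_def)
qed

lemma dist_le_rank_if_two_neighbours:
  assumes "w \<in> V" "x \<in> V" "2 \<le> card (neighbours V E w)"
  shows "d w x \<le> max 1 (card {y \<in> V - {w}. d w y < d w x})"
proof (cases "2 \<le> d w x")
  case True
  have "1 \<le> card (layer w j)" if "j < d w x" for j
    using layer_nonempty[OF assms(1,2), of j] that finite_layer[of w j]
    by (simp add: Suc_le_eq card_gt_0_iff)
  then have "(\<Sum>j=2..<d w x. 1) \<le> (\<Sum>j=2..<d w x. card (layer w j))"
    by (intro sum_mono) simp
  then have "d w x \<le> card (layer w 1) + (\<Sum>j=2..<d w x. card (layer w j))"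
    using assms(3) layer_1[OF assms(1)] True by simp
  also have "\<dots> = card {y \<in> V - {w}. d w y < d w x}"
    unfolding card_dist_less[OF assms(1)]
    using True by (simp add: sum.atLeast_Suc_lessThan numeral_2_eq_2)
  finally show ?thesis by simp
qed simp

lemma card_layer_Suc_le:
  assumes degree: "\<And>v. v \<in> V \<Longrightarrow> card (neighbours V E v) \<le> 2" and w: "w \<in> V" and "0 < k"
  shows "card (layer w (Suc k)) \<le> card (layer w k)"
proof -
  obtain l where k: "k = Suc l" using \<open>0 < k\<close> by (cases k) auto
  have "\<forall>x\<in>layer w (Suc k). \<exists>y. y \<in> neighbours V E x \<and> d w y = k"
    using w by (auto simp: layer_def elim: dist_predecessor)
  from bchoice[OF this] obtain pred where
    pred: "\<And>x. x \<in> layer w (Suc k) \<Longrightarrow> pred x \<in> neighbours V E x \<and> d w (pred x) = k"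
    by blast
  have "inj_on pred (layer w (Suc k))"
  proof (rule inj_onI, rule ccontr)
    fix x y assume xy: "x \<in> layer w (Suc k)" "y \<in> layer w (Suc k)" "pred x = pred y" "x \<noteq> y"
    define z where "z = pred x"
    have z: "z \<in> V" "d w z = Suc l" using pred[OF xy(1)] k by (auto simp: z_def neighbours_def)
    obtain p where p: "p \<in> neighbours V E z" "d w p = l" by (rule dist_predecessor[OF w z])
    have "{p, x, y} \<subseteq> neighbours V E z"
      using p(1) pred[OF xy(1)] pred[OF xy(2)] xy
      by (auto simp: z_def layer_def intro: neighbours_sym)
    moreover have "p \<noteq> x" "p \<noteq> y" using p(2) xy k by (auto simp: layer_def)
    then have "card {p, x, y} = 3" using xy(4) by simp
    ultimately show False
      using card_mono[OF finite_neighbours, of "{p, x, y}" z] degree[OF z(1)] by simp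
  qed
  moreover have "pred ` layer w (Suc k) \<subseteq> layer w k"
    using pred by (auto simp: layer_def neighbours_def)
  ultimately show ?thesis by (intro card_inj_on_le finite_layer)
qed

lemma card_layer_le_2:
  assumes "\<And>v. v \<in> V \<Longrightarrow> card (neighbours V E v) \<le> 2" "w \<in> V" "0 < k"
  shows "card (layer w k) \<le> 2"
  using assms(3)
proof (induction k rule: nat_induct_non_zero)
  case 1
  then show ?case using assms(1)[OF assms(2)] layer_1[OF assms(2)] by simp
next
  case (Suc k)
  then show ?case using card_layer_Suc_le[OF assms(1,2) Suc.hyps] by simp
qed

lemma reciprocal_transmission_eq_sum_others:
  "w \<in> V \<Longrightarrow> reciprocal_transmission w = (\<Sum>v\<in>V - {w}. 1 / real (d w v))"
  using finite_verts
  by (simp add: reciprocal_transmission_def sum.remove[of V w] graph_dist_self)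

lemma reciprocal_transmission_le_if_degree_le_2:
  assumes degree: "\<And>v. v \<in> V \<Longrightarrow> card (neighbours V E v) \<le> 2" and w: "w \<in> V"
  shows "reciprocal_transmission w \<le> cycle_transmission (card V - 1)"
proof -
  have "(\<Sum>v\<in>V - {w}. 1 / real (d w v)) \<le> (\<Sum>i<card (V - {w}). 1 / real (i div 2 + 1))"
  proof (rule sum_le_by_rank[of _ "d w"])
    fix v i assume v: "v \<in> V - {w}" and i: "i < card {y \<in> V - {w}. d w y \<le> d w v}"
    have "card {y \<in> V - {w}. d w y \<le> d w v} = (\<Sum>j=1..<Suc (d w v). card (layer w j))"
      using card_dist_less[OF w, of "Suc (d w v)"] by (simp add: less_Suc_eq_le)
    also have "\<dots> \<le> (\<Sum>j=1..<Suc (d w v). 2)"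
      using card_layer_le_2[OF degree w] by (intro sum_mono) simp
    finally have "i div 2 + 1 \<le> d w v" using i by simp
    then show "1 / real (d w v) \<le> 1 / real (i div 2 + 1)" by (intro divide_left_mono) auto
  qed (simp add: finite_verts)
  then show ?thesis
    using w by (simp add: reciprocal_transmission_eq_sum_others cycle_transmission_def)
qed

lemma two_cycle_harary_eq_sum:
  "2 * cycle_harary (card V - 1) = (\<Sum>w\<in>V. cycle_transmission (card V - 1))"
proof -
  have "0 < card V"
    using connected finite_verts by (simp add: graph_connected_def card_gt_0_iff)
  then show ?thesis by (simp add: cycle_harary_def)
qed

lemma harary_index_le_if_degree_le_2:
  assumes "\<And>v. v \<in> V \<Longrightarrow> card (neighbours V E v) \<le> 2"
  shows "harary_index V E \<le> cycle_harary (card V - 1)"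
proof -
  have "2 * harary_index V E \<le> 2 * cycle_harary (card V - 1)"
    unfolding harary_index_eq_sum two_cycle_harary_eq_sum
    by (intro sum_mono reciprocal_transmission_le_if_degree_le_2 assms)
  then show ?thesis by simp
qed

definition wide_layers :: "'a \<Rightarrow> bool" where
  "wide_layers w \<longleftrightarrow> (\<forall>v\<in>V. \<forall>k. 0 < k \<longrightarrow> k < d w v \<longrightarrow> 2 \<le> card (layer w k))"

lemma dist_le_half_rank_if_wide_layers:
  assumes "wide_layers w" "w \<in> V" "v \<in> V" "v \<noteq> w"
  shows "d w v \<le> card {y \<in> V - {w}. d w y < d w v} div 2 + 1"
proof -
  have "2 * (d w v - 1) = (\<Sum>j=1..<d w v. 2)" by simp
  also have "\<dots> \<le> (\<Sum>j=1..<d w v. card (layer w j))"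
    using assms(1,3) by (intro sum_mono) (auto simp: wide_layers_def Suc_le_eq)
  finally show ?thesis using card_dist_less[OF assms(2), of "d w v"] by simp
qed

lemma sum_inverse_le_reciprocal_transmission_if_wide_layers:
  assumes wide: "wide_layers w" and w: "w \<in> V"
  defines "b \<equiv> \<lambda>i. if i < card (neighbours V E w) then 1 else i div 2 + 1"
  shows "(\<Sum>i<card V - 1. 1 / real (b i)) \<le> reciprocal_transmission w"
proof -
  have "(\<Sum>i<card (V - {w}). 1 / real (b i)) \<le> (\<Sum>v\<in>V - {w}. 1 / real (d w v))"
  proof (rule sum_ge_by_rank[of _ "d w"])
    fix v i assume v: "v \<in> V - {w}" and rank: "card {y \<in> V - {w}. d w y < d w v} \<le> i"
    have pos: "0 < d w v" using dist_pos_iff[OF w, of v] v by auto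
    have "d w v \<le> b i"
    proof (cases "d w v = 1")
      case True
      then show ?thesis by (simp add: b_def)
    next
      case False
      with pos have "1 \<in> {1..<d w v}" by simp
      then have "card (layer w 1) \<le> (\<Sum>j=1..<d w v. card (layer w j))"
        by (intro member_le_sum) auto
      then have "card (neighbours V E w) \<le> i"
        using rank card_dist_less[OF w, of "d w v"] layer_1[OF w] by simp
      moreover have "d w v \<le> i div 2 + 1"
        using dist_le_half_rank_if_wide_layers[OF wide w, of v] v div_le_mono[OF rank, of 2]
        by simp
      ultimately show ?thesis by (simp add: b_def)
    qed
    with pos show "1 / real (b i) \<le> 1 / real (d w v)" by (intro divide_left_mono) auto
  qed (simp add: finite_verts)
  then show ?thesis using w by (simp add: reciprocal_transmission_eq_sum_others)
qed

text \<open>A third neighbour of \<open>w\<close> beats the third of the distances \<open>1, 1, 2, 2, 3, 3, \<dots>\<close> in the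
  cycle.\<close>

lemma cycle_transmission_le_if_wide_layers:
  assumes "wide_layers w" "w \<in> V"
  shows "cycle_transmission (card V - 1) \<le> reciprocal_transmission w"
    and "2 < card (neighbours V E w) \<Longrightarrow>
      cycle_transmission (card V - 1) < reciprocal_transmission w"
proof -
  define b where "b i = (if i < card (neighbours V E w) then 1 else i div 2 + 1)" for i
  have sum_b_le: "(\<Sum>i<card V - 1. 1 / real (b i)) \<le> reciprocal_transmission w"
    unfolding b_def by (rule sum_inverse_le_reciprocal_transmission_if_wide_layers[OF assms])
  have summand_le: "1 / real (i div 2 + 1) \<le> 1 / real (b i)" for i
    by (simp add: b_def)
  have "cycle_transmission (card V - 1) \<le> (\<Sum>i<card V - 1. 1 / real (b i))"
    unfolding cycle_transmission_def by (intro sum_mono summand_le)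
  with sum_b_le show "cycle_transmission (card V - 1) \<le> reciprocal_transmission w" by simp
  assume degree: "2 < card (neighbours V E w)"
  have "neighbours V E w \<subseteq> V - {w}"
    using adjacent_in_verts(3) by (auto simp: neighbours_def)
  from card_mono[OF _ this] have "2 < card V - 1" using degree finite_verts assms(2) by simp
  moreover have "1 / real (2 div 2 + 1) < 1 / real (b 2)" using degree by (simp add: b_def)
  ultimately have "cycle_transmission (card V - 1) < (\<Sum>i<card V - 1. 1 / real (b i))"
    unfolding cycle_transmission_def using summand_le
    by (intro sum_strict_mono_ex1 bexI[of _ 2]) auto
  with sum_b_le show "cycle_transmission (card V - 1) < reciprocal_transmission w" by simp
qed

lemma cycle_harary_le_if_wide_layers:
  assumes "\<And>w. w \<in> V \<Longrightarrow> wide_layers w"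
  shows "cycle_harary (card V - 1) \<le> harary_index V E"
    and "v \<in> V \<Longrightarrow> 2 < card (neighbours V E v) \<Longrightarrow> cycle_harary (card V - 1) < harary_index V E"
proof -
  note transmission = cycle_transmission_le_if_wide_layers[OF assms]
  have "2 * cycle_harary (card V - 1) \<le> 2 * harary_index V E"
    unfolding harary_index_eq_sum two_cycle_harary_eq_sum by (intro sum_mono transmission(1))
  then show "cycle_harary (card V - 1) \<le> harary_index V E" by simp
  assume "v \<in> V" "2 < card (neighbours V E v)"
  then have "2 * cycle_harary (card V - 1) < 2 * harary_index V E"
    unfolding harary_index_eq_sum two_cycle_harary_eq_sum
    using transmission finite_verts by (intro sum_strict_mono_ex1) auto
  then show "cycle_harary (card V - 1) < harary_index V E" by simp
qed

end

section \<open>Separations at a vertex\<close>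

definition induced_edges :: "'a set set \<Rightarrow> 'a set \<Rightarrow> 'a set set" where
  "induced_edges E U = {e \<in> E. e \<subseteq> U}"

definition separation :: "'a set \<Rightarrow> 'a set set \<Rightarrow> 'a set \<Rightarrow> 'a set \<Rightarrow> 'a \<Rightarrow> bool" where
  "separation V E V1 V2 w \<longleftrightarrow>
     V = V1 \<union> V2 \<and> V1 \<inter> V2 = {w} \<and> (\<forall>e\<in>E. e \<subseteq> V1 \<or> e \<subseteq> V2)"

lemma separation_sym: "separation V E V1 V2 w \<Longrightarrow> separation V E V2 V1 w"
  by (auto simp: separation_def)

lemma weak_hom_separation_part:
  "separation V E V1 V2 w \<Longrightarrow> weak_hom id V1 (induced_edges E V1) V E"
  by (auto simp: separation_def induced_edges_def intro: weak_hom_subgraph)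

lemma weak_hom_collapse_separation:
  assumes "separation V E V1 V2 w"
  shows "weak_hom (\<lambda>x. if x \<in> V1 then x else w) V E V1 (induced_edges E V1)"
  unfolding weak_hom_def
proof (intro conjI ballI impI)
  have cut: "w \<in> V1" "x \<in> V1 \<Longrightarrow> x \<in> V2 \<Longrightarrow> x = w" for x
    using assms by (auto simp: separation_def)
  then show "(\<lambda>x. if x \<in> V1 then x else w) ` V \<subseteq> V1" by auto
  fix x y assume "{x, y} \<in> E"
  moreover from this consider "{x, y} \<subseteq> V1" | "{x, y} \<subseteq> V2"
    using assms by (auto simp: separation_def)
  ultimately show "(if x \<in> V1 then x else w) = (if y \<in> V1 then y else w) \<or>
      {if x \<in> V1 then x else w, if y \<in> V1 then y else w} \<in> induced_edges E V1"
    using cut by cases (auto simp: induced_edges_def)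
qed

lemma graph_connected_separation:
  assumes "graph_connected V E" "separation V E V1 V2 w"
  shows "graph_connected V1 (induced_edges E V1)"
proof (rule weak_hom_graph_connected[OF weak_hom_collapse_separation[OF assms(2)] _ assms(1)])
  show "(\<lambda>x. if x \<in> V1 then x else w) ` V = V1"
    using assms(2) by (fastforce simp: separation_def)
qed

lemma (in connected_sgraph) connected_sgraph_separation:
  assumes "separation V E V1 V2 w"
  shows "connected_sgraph V1 (induced_edges E V1)"
proof
  show "graph_connected V1 (induced_edges E V1)"
    by (rule graph_connected_separation[OF connected assms])
qed (use assms finite_verts edge_card in \<open>auto simp: separation_def induced_edges_def\<close>)

locale two_edge_connected_sgraph = fin_sgraph V E for V :: "'a set" and E +
  assumes two_edge_connected: "two_edge_connected V E"

sublocale two_edge_connected_sgraph \<subseteq> connected_sgraph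
  using two_edge_connected by unfold_locales (simp add: two_edge_connected_def)

context two_edge_connected_sgraph
begin

lemma two_edge_connected_sgraph_separation:
  assumes sep: "separation V E V1 V2 w" and "1 < card V1"
  shows "two_edge_connected_sgraph V1 (induced_edges E V1)"
proof -
  interpret V1: connected_sgraph V1 "induced_edges E V1"
    by (rule connected_sgraph_separation[OF sep])
  have "graph_connected V1 (induced_edges E V1 - {e})" if "e \<in> induced_edges E V1" for e
  proof -
    have "graph_connected V (E - {e})"
      using that two_edge_connected by (simp add: two_edge_connected_def induced_edges_def)
    moreover have "separation V (E - {e}) V1 V2 w" using sep by (simp add: separation_def)
    ultimately have "graph_connected V1 (induced_edges (E - {e}) V1)"
      by (rule graph_connected_separation)
    moreover have "induced_edges (E - {e}) V1 = induced_edges E V1 - {e}"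
      by (auto simp: induced_edges_def)
    ultimately show ?thesis by simp
  qed
  then show ?thesis
    using assms(2) V1.connected by unfold_locales (simp add: two_edge_connected_def)
qed

lemma card_neighbours_ge_2:
  assumes "w \<in> V"
  shows "2 \<le> card (neighbours V E w)"
proof -
  have "V \<noteq> {w}" using two_edge_connected by (auto simp: two_edge_connected_def)
  then obtain v where v: "v \<in> V" "w \<noteq> v" using assms by blast
  obtain a where a: "{w, a} \<in> E"
    using graph_connected_has_incident_edge[OF connected assms v] by blast
  then have "graph_connected V (E - {{w, a}})"
    using two_edge_connected by (simp add: two_edge_connected_def)
  then obtain b where b: "{w, b} \<in> E - {{w, a}}"
    using graph_connected_has_incident_edge[OF _ assms v] by blast
  then have "{a, b} \<subseteq> neighbours V E w" "a \<noteq> b" using a by (auto simp: in_neighbours_iff)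
  then show ?thesis using card_mono[OF finite_neighbours, of "{a, b}" w] by simp
qed

end

lemma (in connected_sgraph) separation_at_layer:
  assumes "u \<in> V" "layer u k = {w}"
  shows "separation V E {x \<in> V. d u x \<le> k} {x \<in> V. k \<le> d u x} w"
proof -
  have "e \<subseteq> {x \<in> V. d u x \<le> k} \<or> e \<subseteq> {x \<in> V. k \<le> d u x}" if e: "e \<in> E" for e
  proof -
    obtain a b where ab: "e = {a, b}" using edge_card[OF e] by (auto simp: card_2_iff)
    with e have "{a, b} \<in> E" "{b, a} \<in> E" by (simp_all add: insert_commute)
    from this[THEN dist_adjacent_le[OF assms(1)]]
    have "d u a \<le> k \<and> d u b \<le> k \<or> k \<le> d u a \<and> k \<le> d u b" by linarith
    then show ?thesis using edge_in_verts[OF e] by (auto simp: ab)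
  qed
  moreover have "{x \<in> V. d u x \<le> k} \<inter> {x \<in> V. k \<le> d u x} = layer u k"
    "V = {x \<in> V. d u x \<le> k} \<union> {x \<in> V. k \<le> d u x}"
    by (auto simp: layer_def)
  ultimately show ?thesis using assms(2) by (simp add: separation_def)
qed

lemma (in connected_sgraph) separation_if_not_wide_layers:
  assumes "u \<in> V" "\<not> wide_layers u"
  obtains V1 V2 w where "separation V E V1 V2 w" "1 < card V1" "1 < card V2"
proof -
  obtain k y where k: "0 < k" "k < d u y" and y: "y \<in> V" and narrow: "card (layer u k) < 2"
    using assms(2) by (auto simp: wide_layers_def not_le)
  have "layer u k \<noteq> {}" using layer_nonempty[OF assms(1) y, of k] k by simp
  then have "card (layer u k) = 1"
    using narrow finite_layer[of u k] by (simp add: card_gt_0_iff less_2_cases_iff)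
  then obtain w where w: "layer u k = {w}" by (auto simp: card_1_singleton_iff)
  then have w_in: "w \<in> V" "d u w = k" by (auto simp: layer_def)
  have "card {w, u} \<le> card {x \<in> V. d u x \<le> k}"
    using finite_verts assms(1) w_in by (intro card_mono) (auto simp: graph_dist_self)
  moreover have "card {w, y} \<le> card {x \<in> V. k \<le> d u x}"
    using finite_verts y w_in k by (intro card_mono) auto
  moreover have "w \<noteq> u" "w \<noteq> y" using w_in k assms(1) by (auto simp: graph_dist_self)
  ultimately show thesis using that[OF separation_at_layer[OF assms(1) w]] by simp
qed

section \<open>The Harary index across a separation\<close>

lemma sum_symmetric_disjoint_union:
  fixes g :: "'a \<Rightarrow> 'a \<Rightarrow> 'b::comm_semiring_1"
  assumes "finite A" "finite B" "A \<inter> B = {}" and sym: "\<And>x y. g x y = g y x"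
  shows "(\<Sum>x\<in>A \<union> B. \<Sum>y\<in>A \<union> B. g x y) =
    (\<Sum>x\<in>A. \<Sum>y\<in>A. g x y) + (\<Sum>x\<in>B. \<Sum>y\<in>B. g x y) + 2 * (\<Sum>x\<in>A. \<Sum>y\<in>B. g x y)"
proof -
  have "(\<Sum>x\<in>B. \<Sum>y\<in>A. g x y) = (\<Sum>x\<in>A. \<Sum>y\<in>B. g x y)"
    by (subst sum.swap) (intro sum.cong refl sym)
  then show ?thesis
    by (simp add: sum.union_disjoint[OF assms(1-3)] sum.distrib algebra_simps mult_2)
qed

lemma sum_symmetric_union_singleton_overlap:
  fixes g :: "'a \<Rightarrow> 'a \<Rightarrow> 'b::comm_semiring_1"
  assumes fin: "finite A" "finite B" and "A \<inter> B = {w}"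
    and sym: "\<And>x y. g x y = g y x" and zero: "g w w = 0"
  shows "(\<Sum>x\<in>A \<union> B. \<Sum>y\<in>A \<union> B. g x y) =
    (\<Sum>x\<in>A. \<Sum>y\<in>A. g x y) + (\<Sum>x\<in>B. \<Sum>y\<in>B. g x y)
      + 2 * (\<Sum>x\<in>A - {w}. \<Sum>y\<in>B - {w}. g x y)"
proof -
  have AB: "A \<union> B = A \<union> (B - {w})" "A \<inter> (B - {w}) = {}" "w \<in> A" "w \<in> B"
    using assms(3) by auto
  have "(\<Sum>x\<in>B. \<Sum>y\<in>B. g x y) =
      (\<Sum>x\<in>B - {w}. \<Sum>y\<in>B - {w}. g x y) + 2 * (\<Sum>y\<in>B - {w}. g w y)"
    using sum_symmetric_disjoint_union[of "{w}" "B - {w}" g, OF _ _ _ sym] fin(2) zero AB(4)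
    by (simp add: insert_absorb)
  moreover have "(\<Sum>x\<in>A. \<Sum>y\<in>B - {w}. g x y) =
      (\<Sum>y\<in>B - {w}. g w y) + (\<Sum>x\<in>A - {w}. \<Sum>y\<in>B - {w}. g x y)"
    by (rule sum.remove[OF fin(1) AB(3)])
  ultimately show ?thesis
    using sum_symmetric_disjoint_union[of A "B - {w}" g, OF _ _ AB(2) sym] fin
    by (simp add: algebra_simps flip: AB(1))
qed

context connected_sgraph
begin

lemma dist_separation_le:
  assumes sep: "separation V E V1 V2 w" and "x \<in> V1" "y \<in> V2"
  shows "d x y \<le>
    graph_dist V1 (induced_edges E V1) w x + graph_dist V2 (induced_edges E V2) w y"
proof -
  interpret G1: connected_sgraph V1 "induced_edges E V1"
    by (rule connected_sgraph_separation[OF sep])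
  interpret G2: connected_sgraph V2 "induced_edges E V2"
    by (rule connected_sgraph_separation[OF separation_sym[OF sep]])
  have w: "w \<in> V1" "w \<in> V2" and in_V: "x \<in> V" "y \<in> V" "w \<in> V"
    using sep assms(2,3) by (auto simp: separation_def)
  have "d x y \<le> d w x + d w y"
    using dist_triangle[OF in_V(1,3,2)] by (simp add: graph_dist_commute[of V E w x])
  moreover have "d w x \<le> G1.d w x"
    using G1.weak_hom_dist_le[OF weak_hom_separation_part[OF sep] w(1) assms(2)] by simp
  moreover have "d w y \<le> G2.d w y"
    using G2.weak_hom_dist_le[OF weak_hom_separation_part[OF separation_sym[OF sep]] w(2) assms(3)]
    by simp
  ultimately show ?thesis by linarith
qed

lemma harary_index_part_le:
  assumes "separation V E V1 V2 w"
  shows "2 * harary_index V1 (induced_edges E V1) \<le> (\<Sum>x\<in>V1. \<Sum>y\<in>V1. 1 / real (d x y))"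
proof -
  interpret G1: connected_sgraph V1 "induced_edges E V1"
    by (rule connected_sgraph_separation[OF assms])
  show ?thesis
    unfolding G1.harary_index_eq_sum G1.reciprocal_transmission_def
    using G1.inverse_dist_le_if_inj_weak_hom[OF connected_sgraph_axioms
        weak_hom_separation_part[OF assms]]
    by (intro sum_mono) simp
qed

lemma harary_index_separation_ge:
  assumes sep: "separation V E V1 V2 w"
  defines "E1 \<equiv> induced_edges E V1" and "E2 \<equiv> induced_edges E V2"
  shows "harary_index V1 E1 + harary_index V2 E2
      + (\<Sum>x\<in>V1 - {w}. \<Sum>y\<in>V2 - {w}. 1 / real (graph_dist V1 E1 w x + graph_dist V2 E2 w y))
    \<le> harary_index V E"
proof -
  have V: "V = V1 \<union> V2" "V1 \<inter> V2 = {w}" and w: "w \<in> V"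
    using sep by (auto simp: separation_def)
  have fin: "finite V1" "finite V2" using finite_verts V(1) by auto
  have "1 / real (graph_dist V1 E1 w x + graph_dist V2 E2 w y) \<le> 1 / real (d x y)"
    if xy: "x \<in> V1 - {w}" "y \<in> V2 - {w}" for x y
  proof -
    have "x \<in> V" "y \<in> V" "x \<noteq> y" using xy V by auto
    then have "0 < d x y" by (simp add: dist_pos_iff)
    then show ?thesis
      using dist_separation_le[OF sep, of x y] xy unfolding E1_def E2_def
      by (intro divide_left_mono) auto
  qed
  then have "(\<Sum>x\<in>V1 - {w}. \<Sum>y\<in>V2 - {w}. 1 / real (graph_dist V1 E1 w x + graph_dist V2 E2 w y))
      \<le> (\<Sum>x\<in>V1 - {w}. \<Sum>y\<in>V2 - {w}. 1 / real (d x y))"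
    by (intro sum_mono)
  moreover have "2 * harary_index V E = (\<Sum>x\<in>V1. \<Sum>y\<in>V1. 1 / real (d x y))
      + (\<Sum>x\<in>V2. \<Sum>y\<in>V2. 1 / real (d x y))
      + 2 * (\<Sum>x\<in>V1 - {w}. \<Sum>y\<in>V2 - {w}. 1 / real (d x y))"
    unfolding harary_index_eq_sum reciprocal_transmission_def
    by (rule sum_symmetric_union_singleton_overlap[OF fin V(2), folded V(1)])
      (simp_all add: graph_dist_commute graph_dist_self w)
  ultimately show ?thesis
    using harary_index_part_le[OF sep] harary_index_part_le[OF separation_sym[OF sep]]
    unfolding E1_def E2_def by linarith
qed

end

lemma (in connected_sgraph) sum_inverse_shifted_dist_ge:
  assumes "w \<in> V" "2 \<le> card (neighbours V E w)"
  shows "(\<Sum>i<card V - 1. 1 / real (c + max 1 i)) \<le> (\<Sum>x\<in>V - {w}. 1 / real (c + d w x))"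
proof -
  have "(\<Sum>i<card (V - {w}). 1 / real (c + max 1 i)) \<le> (\<Sum>x\<in>V - {w}. 1 / real (c + d w x))"
  proof (rule sum_ge_by_rank[of _ "d w"])
    fix x i assume x: "x \<in> V - {w}" and i: "card {y \<in> V - {w}. d w y < d w x} \<le> i"
    have "d w x \<le> max 1 i"
      using dist_le_rank_if_two_neighbours[OF assms(1) _ assms(2), of x] x i by force
    moreover have "0 < d w x" using dist_pos_iff[OF assms(1), of x] x by auto
    ultimately show "1 / real (c + max 1 i) \<le> 1 / real (c + d w x)"
      by (intro divide_left_mono) auto
  qed (simp add: finite_verts)
  then show ?thesis using assms(1) by simp
qed

lemma cross_sum_le_sum_inverse_dist:
  assumes "connected_sgraph V1 E1" "w1 \<in> V1" "2 \<le> card (neighbours V1 E1 w1)"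
    and "connected_sgraph V2 E2" "w2 \<in> V2" "2 \<le> card (neighbours V2 E2 w2)"
  shows "cross_sum (card V1 - 1) (card V2 - 1) \<le>
    (\<Sum>x\<in>V1 - {w1}. \<Sum>y\<in>V2 - {w2}. 1 / real (graph_dist V1 E1 w1 x + graph_dist V2 E2 w2 y))"
proof -
  interpret G1: connected_sgraph V1 E1 by fact
  interpret G2: connected_sgraph V2 E2 by fact
  have "cross_sum (card V1 - 1) (card V2 - 1) \<le>
      (\<Sum>i<card V1 - 1. \<Sum>y\<in>V2 - {w2}. 1 / real (max 1 i + G2.d w2 y))"
    unfolding cross_sum_def
    by (rule sum_mono) (rule G2.sum_inverse_shifted_dist_ge[OF assms(5,6)])
  also have "\<dots> = (\<Sum>y\<in>V2 - {w2}. \<Sum>i<card V1 - 1. 1 / real (G2.d w2 y + max 1 i))"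
    by (subst sum.swap) (simp add: add.commute)
  also have "\<dots> \<le> (\<Sum>y\<in>V2 - {w2}. \<Sum>x\<in>V1 - {w1}. 1 / real (G2.d w2 y + G1.d w1 x))"
    by (rule sum_mono) (rule G1.sum_inverse_shifted_dist_ge[OF assms(2,3)])
  also have "\<dots> = (\<Sum>x\<in>V1 - {w1}. \<Sum>y\<in>V2 - {w2}. 1 / real (G1.d w1 x + G2.d w2 y))"
    by (subst sum.swap) (simp add: add.commute)
  finally show ?thesis .
qed

lemma (in two_edge_connected_sgraph) cycle_harary_less_if_separation:
  assumes sep: "separation V E V1 V2 w" and card: "1 < card V1" "1 < card V2"
    and "cycle_harary (card V1 - 1) \<le> harary_index V1 (induced_edges E V1)"
    and "cycle_harary (card V2 - 1) \<le> harary_index V2 (induced_edges E V2)"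
  shows "cycle_harary (card V - 1) < harary_index V E"
proof -
  interpret G1: two_edge_connected_sgraph V1 "induced_edges E V1"
    by (rule two_edge_connected_sgraph_separation[OF sep card(1)])
  interpret G2: two_edge_connected_sgraph V2 "induced_edges E V2"
    by (rule two_edge_connected_sgraph_separation[OF separation_sym[OF sep] card(2)])
  have w: "w \<in> V1" "w \<in> V2" and cut: "V = V1 \<union> V2" "V1 \<inter> V2 = {w}"
    using sep by (auto simp: separation_def)
  have "card V - 1 = (card V1 - 1) + (card V2 - 1)"
    using card_Un_Int[OF G1.finite_verts G2.finite_verts] card by (simp add: cut)
  moreover have "0 < gluing_excess (card V1 - 1) (card V2 - 1)"
    using two_edge_connected_card_ge_3[OF G1.fin_sgraph_axioms G1.two_edge_connected]
      two_edge_connected_card_ge_3[OF G2.fin_sgraph_axioms G2.two_edge_connected]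
    by (intro gluing_excess_pos) auto
  moreover note harary_index_separation_ge[OF sep]
    cross_sum_le_sum_inverse_dist[OF G1.connected_sgraph_axioms w(1)
      G1.card_neighbours_ge_2[OF w(1)] G2.connected_sgraph_axioms w(2)
      G2.card_neighbours_ge_2[OF w(2)]]
  ultimately show ?thesis using assms(4,5) by (simp add: gluing_excess_def)
qed

lemma cycle_harary_le_harary_index:
  assumes "two_edge_connected_sgraph V E"
  shows "cycle_harary (card V - 1) \<le> harary_index V E"
  using assms
proof (induction "card V" arbitrary: V E rule: less_induct)
  case less
  interpret two_edge_connected_sgraph V E by fact
  show ?case
  proof (cases "\<forall>u\<in>V. wide_layers u")
    case True
    then show ?thesis by (intro cycle_harary_le_if_wide_layers(1)) blast
  next
    case False
    then obtain V1 V2 w where sep: "separation V E V1 V2 w" and card: "1 < card V1" "1 < card V2"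
      using separation_if_not_wide_layers by blast
    have parts: "V = V1 \<union> V2" "V1 \<inter> V2 = {w}" using sep by (auto simp: separation_def)
    have "finite V1" "finite V2" using finite_verts parts(1) by auto
    then have "card V1 < card V" "card V2 < card V"
      using card_Un_Int[of V1 V2] card by (simp_all add: parts)
    then show ?thesis
      using cycle_harary_less_if_separation[OF sep card] less.hyps
        two_edge_connected_sgraph_separation[OF sep card(1)]
        two_edge_connected_sgraph_separation[OF separation_sym[OF sep] card(2)]
      by (meson less_imp_le)
  qed
qed

lemma (in two_edge_connected_sgraph) regular_2_if_harary_index_le:
  assumes "harary_index V E \<le> cycle_harary (card V - 1)"
  shows "regular_graph V E 2"
proof -
  have "wide_layers u" if u: "u \<in> V" for u
  proof (rule ccontr)
    assume "\<not> wide_layers u"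
    then obtain V1 V2 w where sep: "separation V E V1 V2 w" and card: "1 < card V1" "1 < card V2"
      using separation_if_not_wide_layers[OF u] by blast
    from cycle_harary_less_if_separation[OF sep card] assms show False
      using cycle_harary_le_harary_index two_edge_connected_sgraph_separation[OF sep card(1)]
        two_edge_connected_sgraph_separation[OF separation_sym[OF sep] card(2)]
      by fastforce
  qed
  then have "\<not> 2 < card (neighbours V E v)" if "v \<in> V" for v
    using cycle_harary_le_if_wide_layers(2)[OF _ that] assms by fastforce
  then show ?thesis
    using card_neighbours_ge_2 unfolding regular_graph_def by (meson le_antisym not_le)
qed

section \<open>Cycles and connected 2-regular graphs\<close>

lemma eq_Suc_mod_iff:
  assumes "i < n" "j < n"
  shows "i = Suc j mod n \<longleftrightarrow> j = (i + n - 1) mod n"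
proof -
  have "Suc j mod n = (if Suc j = n then 0 else Suc j)" using assms(2) by simp
  moreover have "(i + n - 1) mod n = (if i = 0 then n - 1 else i - 1)"
    using assms(1) by (cases i) simp_all
  ultimately show ?thesis using assms by (cases i) auto
qed

lemma neighbours_cycle:
  assumes "i < n"
  shows "neighbours (cycle_verts n) (cycle_edges n) i = {Suc i mod n, (i + n - 1) mod n}"
proof -
  have "{i, j} \<in> cycle_edges n \<longleftrightarrow> j = Suc i mod n \<or> j = (i + n - 1) mod n" if "j < n" for j
  proof -
    have "{i, j} \<in> cycle_edges n \<longleftrightarrow> j = Suc i mod n \<or> i = Suc j mod n"
      using assms that by (auto simp: cycle_edges_def doubleton_eq_iff)
    then show ?thesis by (simp only: eq_Suc_mod_iff[OF assms that])
  qed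
  moreover have "Suc i mod n < n" "(i + n - 1) mod n < n" using assms by auto
  ultimately show ?thesis unfolding neighbours_def cycle_verts_def by blast
qed

lemma connected_sgraph_cycle:
  assumes "3 \<le> n"
  shows "connected_sgraph (cycle_verts n) (cycle_edges n)"
proof -
  have from_0: "\<exists>xs. walk_betw (cycle_verts n) (cycle_edges n) i xs 0" if "i < n" for i
    using that
  proof (induction i)
    case 0
    then have "walk_betw (cycle_verts n) (cycle_edges n) 0 [0] 0"
      by (intro walk_betw_single) (simp add: cycle_verts_def)
    then show ?case by blast
  next
    case (Suc i)
    then obtain xs where xs: "walk_betw (cycle_verts n) (cycle_edges n) i xs 0" by auto
    have "i \<in> neighbours (cycle_verts n) (cycle_edges n) (Suc i)"
      using Suc.prems by (simp add: neighbours_cycle)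
    then have "walk_betw (cycle_verts n) (cycle_edges n) (Suc i) (Suc i # xs) 0"
      using Suc.prems
      by (intro walk_betw_Cons[OF xs]) (simp_all add: neighbours_def cycle_verts_def)
    then show ?case by (rule exI)
  qed
  have "\<exists>xs. walk_betw (cycle_verts n) (cycle_edges n) u xs v" if uv: "u < n" "v < n" for u v
  proof -
    obtain xs ys where "walk_betw (cycle_verts n) (cycle_edges n) u xs 0"
        "walk_betw (cycle_verts n) (cycle_edges n) v ys 0"
      using from_0[OF uv(1)] from_0[OF uv(2)] by blast
    from walk_betw_append[OF this(1) walk_betw_rev[OF this(2)]] show ?thesis by (rule exI)
  qed
  then have "graph_connected (cycle_verts n) (cycle_edges n)"
    using assms by (auto simp: graph_connected_def cycle_verts_def lessThan_empty_iff)
  with fin_sgraph_cycle[OF assms] show ?thesis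
    by (simp add: connected_sgraph_def connected_sgraph_axioms_def)
qed

lemma harary_index_cycle_le:
  assumes "3 \<le> n"
  shows "harary_index (cycle_verts n) (cycle_edges n) \<le> cycle_harary (n - 1)"
proof -
  interpret connected_sgraph "cycle_verts n" "cycle_edges n"
    by (rule connected_sgraph_cycle[OF assms])
  have "card (neighbours (cycle_verts n) (cycle_edges n) v) \<le> 2" if "v \<in> cycle_verts n" for v
    using that neighbours_cycle[of v n] by (simp add: cycle_verts_def card_insert_if)
  from harary_index_le_if_degree_le_2[OF this] show ?thesis by (simp add: cycle_verts_def)
qed

context connected_sgraph
begin

definition path :: "'a list \<Rightarrow> bool" where
  "path xs \<longleftrightarrow> xs \<noteq> [] \<and> distinct xs \<and> set xs \<subseteq> V \<and> successively (\<lambda>x y. {x, y} \<in> E) xs"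

definition longest_path :: "'a list \<Rightarrow> bool" where
  "longest_path xs \<longleftrightarrow> path xs \<and> (\<forall>ys. path ys \<longrightarrow> length ys \<le> length xs)"

lemma longest_path_exists: "\<exists>xs. longest_path xs"
proof -
  obtain u where "u \<in> V" using connected by (auto simp: graph_connected_def)
  then have "path [u]" by (simp add: path_def)
  moreover have "length xs < Suc (card V)" if "path xs" for xs
    using that card_mono[OF finite_verts, of "set xs"] distinct_card[of xs] by (simp add: path_def)
  ultimately show ?thesis
    unfolding longest_path_def
    by (intro ex_has_greatest_nat[of path "[u]" length "Suc (card V)"]) simp_all
qed

lemma path_nth_neighbours:
  assumes "path xs" "Suc i < length xs"
  shows "xs ! Suc i \<in> neighbours V E (xs ! i)" "xs ! i \<in> neighbours V E (xs ! Suc i)"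
  using successively_nth[OF _ assms(2)] assms(1)
  by (auto simp: path_def in_neighbours_iff insert_commute)

lemma neighbours_last_longest_path:
  assumes "longest_path xs"
  shows "neighbours V E (last xs) \<subseteq> set xs"
proof
  fix y assume y: "y \<in> neighbours V E (last xs)"
  show "y \<in> set xs"
  proof (rule ccontr)
    assume "y \<notin> set xs"
    then have "path (xs @ [y])"
      using assms y
      by (auto simp: longest_path_def path_def neighbours_def successively_append_iff)
    then have "length (xs @ [y]) \<le> length xs" using assms unfolding longest_path_def by blast
    then show False by simp
  qed
qed

lemma neighbours_eq_if_regular_2:
  assumes "regular_graph V E 2" "u \<in> V" "{a, b} \<subseteq> neighbours V E u" "a \<noteq> b"
  shows "neighbours V E u = {a, b}"
  using card_subset_eq[OF finite_neighbours assms(3)] assms(1,2,4) by (simp add: regular_graph_def)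

definition closed_path :: "'a list \<Rightarrow> bool" where
  "closed_path xs \<longleftrightarrow> path xs \<and> 3 \<le> length xs \<and> hd xs \<in> neighbours V E (last xs)"

text \<open>Besides its predecessor the last vertex has a second neighbour on the path. Were it an inner
  vertex, it would have three neighbours.\<close>

lemma closed_path_longest_path_if_regular_2:
  assumes regular: "regular_graph V E 2" and longest: "longest_path xs"
  shows "closed_path xs"
proof -
  have path: "path xs" using longest by (simp add: longest_path_def)
  define m where "m = length xs"
  have xs: "0 < m" "last xs = xs ! (m - 1)" "distinct xs" "set xs \<subseteq> V"
    using path by (auto simp: m_def path_def last_conv_nth)
  have last_in: "last xs \<in> V" using path last_in_set[of xs] by (auto simp: path_def)
  then have "card (neighbours V E (last xs)) = 2" using regular by (simp add: regular_graph_def)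
  then have "\<not> neighbours V E (last xs) \<subseteq> {xs ! (m - 2)}"
    using card_mono[of "{xs ! (m - 2)}" "neighbours V E (last xs)"] by auto
  then obtain y where y: "y \<in> neighbours V E (last xs)" "y \<noteq> xs ! (m - 2)" by blast
  have "y \<in> set xs" using y(1) neighbours_last_longest_path[OF longest] by blast
  then obtain j where j: "j < m" "y = xs ! j" by (auto simp: in_set_conv_nth m_def)
  have "j \<noteq> m - 1" using y(1) j(2) xs(2) adjacent_in_verts(3) by (auto simp: in_neighbours_iff)
  moreover have "j \<noteq> m - 2" using y(2) j(2) by blast
  ultimately have j_less: "Suc (Suc j) < m" using j(1) by linarith
  have "j = 0"
  proof (rule ccontr)
    assume "j \<noteq> 0"
    then obtain i where i: "j = Suc i" by (cases j) auto
    have "last xs \<in> neighbours V E y" by (rule neighbours_sym[OF y(1)])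
    moreover have "neighbours V E y = {xs ! i, xs ! Suc j}"
    proof (rule neighbours_eq_if_regular_2[OF regular])
      show "y \<in> V" "xs ! i \<noteq> xs ! Suc j"
        using j i xs j_less by (auto simp: nth_eq_iff_index_eq m_def)
      show "{xs ! i, xs ! Suc j} \<subseteq> neighbours V E y"
        using path_nth_neighbours[OF path] j i j_less by (auto simp: m_def)
    qed
    ultimately show False
      using xs i j_less by (auto simp: nth_eq_iff_index_eq m_def)
  qed
  then have "hd xs \<in> neighbours V E (last xs)"
    using y(1) j(2) path by (simp add: hd_conv_nth path_def)
  then show ?thesis using path j_less by (simp add: closed_path_def m_def)
qed

lemma closed_path_nth_neighbours:
  assumes "closed_path xs" "i < length xs"
  shows "xs ! (Suc i mod length xs) \<in> neighbours V E (xs ! i)"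
proof (cases "Suc i = length xs")
  case True
  then have "last xs = xs ! i" by (cases xs rule: rev_cases) auto
  with True show ?thesis using assms by (auto simp: closed_path_def path_def hd_conv_nth)
next
  case False
  then show ?thesis
    using path_nth_neighbours(1)[of xs i] assms by (simp add: closed_path_def)
qed

lemma neighbours_nth_closed_path:
  assumes regular: "regular_graph V E 2" and closed: "closed_path xs" and i: "i < length xs"
  defines "m \<equiv> length xs"
  shows "neighbours V E (xs ! i) = (!) xs ` neighbours (cycle_verts m) (cycle_edges m) i"
proof -
  have xs: "distinct xs" "set xs \<subseteq> V" "3 \<le> m"
    using closed by (auto simp: closed_path_def path_def m_def)
  define succ where "succ = Suc i mod m"
  define pred where "pred = (i + m - 1) mod m"
  have "i < m" using i by (simp add: m_def)
  moreover have "succ < m" "pred < m" using xs(3) by (simp_all add: succ_def pred_def)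
  ultimately have less: "i < m" "succ < m" "pred < m" by blast+
  have "Suc pred mod m = i" using eq_Suc_mod_iff[OF less(1,3)] by (simp add: pred_def)
  then have "xs ! i \<in> neighbours V E (xs ! pred)"
    using closed_path_nth_neighbours[OF closed, of pred] less(3) by (simp add: m_def)
  then have "xs ! pred \<in> neighbours V E (xs ! i)" by (rule neighbours_sym)
  moreover have "xs ! succ \<in> neighbours V E (xs ! i)"
    using closed_path_nth_neighbours[OF closed i] by (simp add: succ_def m_def)
  moreover have "succ \<noteq> pred"
    using less(1) xs(3) by (cases "Suc i = m"; cases i) (auto simp: succ_def pred_def)
  then have "xs ! succ \<noteq> xs ! pred"
    using xs(1) less by (simp add: nth_eq_iff_index_eq m_def)
  moreover have "xs ! i \<in> V" using xs(2) i by auto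
  ultimately have "neighbours V E (xs ! i) = {xs ! succ, xs ! pred}"
    using neighbours_eq_if_regular_2[OF regular] by simp
  then show ?thesis by (simp add: neighbours_cycle[OF less(1)] succ_def pred_def)
qed

lemma set_closed_path:
  assumes "regular_graph V E 2" "closed_path xs"
  shows "set xs = V"
proof
  have xs: "xs \<noteq> []" "set xs \<subseteq> V" using assms(2) by (auto simp: closed_path_def path_def)
  then show "set xs \<subseteq> V" by blast
  show "V \<subseteq> set xs"
  proof (rule verts_subset_if_closed)
    show "hd xs \<in> V" "hd xs \<in> set xs" using xs by auto
    fix x assume "x \<in> set xs"
    then obtain i where "i < length xs" "x = xs ! i" by (auto simp: in_set_conv_nth)
    then show "neighbours V E x \<subseteq> set xs"
      using neighbours_nth_closed_path[OF assms] by (auto simp: neighbours_def cycle_verts_def)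
  qed
qed

lemma graph_iso_cycle_closed_path:
  assumes "regular_graph V E 2" "closed_path xs"
  shows "graph_iso (cycle_verts (length xs)) (cycle_edges (length xs)) V E"
proof -
  let ?m = "length xs"
  have "distinct xs" using assms(2) by (simp add: closed_path_def path_def)
  then have bij: "bij_betw ((!) xs) {..<?m} V"
    using bij_betw_nth set_closed_path[OF assms] by blast
  have "{i, j} \<in> cycle_edges ?m \<longleftrightarrow> {xs ! i, xs ! j} \<in> E" if ij: "i < ?m" "j < ?m" for i j
  proof -
    have "{xs ! i, xs ! j} \<in> E \<longleftrightarrow> xs ! j \<in> neighbours V E (xs ! i)"
      by (simp add: in_neighbours_iff)
    also have "\<dots> \<longleftrightarrow> j \<in> neighbours (cycle_verts ?m) (cycle_edges ?m) i"
      unfolding neighbours_nth_closed_path[OF assms ij(1)] using bij ij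
      by (intro inj_on_image_mem_iff[of _ "{..<?m}"])
        (auto simp: bij_betw_def neighbours_def cycle_verts_def)
    also have "\<dots> \<longleftrightarrow> {i, j} \<in> cycle_edges ?m"
      using ij by (simp add: neighbours_def cycle_verts_def)
    finally show ?thesis by blast
  qed
  with bij show ?thesis unfolding graph_iso_def by (auto simp: cycle_verts_def)
qed

lemma graph_iso_cycle_if_regular_2:
  assumes "regular_graph V E 2"
  shows "graph_iso V E (cycle_verts (card V)) (cycle_edges (card V))"
proof -
  obtain xs where "longest_path xs" using longest_path_exists by blast
  then have closed: "closed_path xs" by (rule closed_path_longest_path_if_regular_2[OF assms])
  then have "distinct xs" by (simp add: closed_path_def path_def)
  then have "length xs = card V"
    using distinct_card[of xs] set_closed_path[OF assms closed] by simp
  with graph_iso_sym[OF graph_iso_cycle_closed_path[OF assms closed]] show ?thesis by simp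
qed

end

theorem theorem5:
  fixes V :: "'a set" and E :: "'a set set" and n :: nat
  assumes "fin_sgraph V E"
    and "two_edge_connected V E"
    and "card V = n"
  shows "harary_index V E \<ge> harary_index (cycle_verts n) (cycle_edges n) \<and>
    (harary_index V E = harary_index (cycle_verts n) (cycle_edges n) \<longleftrightarrow>
      graph_iso V E (cycle_verts n) (cycle_edges n))"
proof -
  interpret G: two_edge_connected_sgraph V E
    by (intro two_edge_connected_sgraph.intro two_edge_connected_sgraph_axioms.intro assms(1,2))
  have n: "3 \<le> n" using two_edge_connected_card_ge_3[OF assms(1,2)] assms(3) by simp
  have upper: "harary_index (cycle_verts n) (cycle_edges n) \<le> cycle_harary (n - 1)"
    by (rule harary_index_cycle_le[OF n])
  have lower: "cycle_harary (n - 1) \<le> harary_index V E"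
    using cycle_harary_le_harary_index[OF G.two_edge_connected_sgraph_axioms] assms(3) by simp
  show ?thesis
  proof (intro conjI iffI)
    show "harary_index (cycle_verts n) (cycle_edges n) \<le> harary_index V E"
      using upper lower by simp
    assume "harary_index V E = harary_index (cycle_verts n) (cycle_edges n)"
    then have "regular_graph V E 2"
      using upper assms(3) by (intro G.regular_2_if_harary_index_le) simp
    then show "graph_iso V E (cycle_verts n) (cycle_edges n)"
      using G.graph_iso_cycle_if_regular_2 assms(3) by simp
  next
    assume "graph_iso V E (cycle_verts n) (cycle_edges n)"
    then show "harary_index V E = harary_index (cycle_verts n) (cycle_edges n)"
      by (rule harary_index_iso[OF G.connected_sgraph_axioms connected_sgraph_cycle[OF n]])
  qed
qed

end
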